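(* Let $m,n\ge 1$, let $A:\mathbb{R}^m\times\mathbb{R}\to\mathbb{S}^n$ and $B:\mathbb{R}^m\to\mathbb{S}^n$, and consider the optimization problem $$\text{(P)}\qquad \underset{x\in\mathbb{R}^m,\ y\in\mathbb{R}}{\text{minimize}}\ \ y\quad\text{subject to}\quad A(x,y)\succeq 0,\ \ B(x)\succeq 0.$$ Assume: (a) for every feasible $y\in\mathbb{R}$, the map $A(\cdot,y):\mathbb{R}^m\to\mathbb{S}^n$ is differentiable and (matrix) concave; and $B:\mathbb{R}^m\to\mathbb{S}^n$ is differentiable and (matrix) concave; (b) for every feasible $x\in\mathbb{R}^m$, the map $A(x,\cdot):\mathbb{R}\to\mathbb{S}^n$ is differentiable and strictly increasing in the Loewner order, i.e. $y>y'$ implies $A(x,y)\succ A(x,y')$. Let $(x^*,y^*,Z^*,W^* )\in\mathbb{R}^m\times\mathbb{R}\times\mathbb{S}^n\times\mathbb{S}^n$ be any tuple satisfying the KKT conditions $$\Big\langle \tfrac{\partial}{\partial x_i}A(x^*,y^* ),Z^*\Big\rangle+\Big\langle \tfrac{\partial}{\partial x_i}B(x^* ),W^*\Big\rangle=0\quad (i=1,\dots,m),$$ $$1-\Big\langle \tfrac{\partial}{\partial y}A(x^*,y^* ),Z^*\Big\rangle=0,$$ $$\langle A(x^*,y^* ),Z^*\rangle=0,\qquad \langle B(x^* ),W^*\rangle=0,$$ $$A(x^*,y^* )\succeq0,\quad B(x^* )\succeq0,\quad Z^*\succeq0,\quad W^*\succeq0.$$ Then $(x^*,y^* )$ is globally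 optimal for (P); that is, $(x^*,y^* )$ is feasible and $y^*\le \bar y$ for every $(\bar x,\bar y)\in\mathbb{R}^m\times\mathbb{R}$ with $A(\bar x,\bar y)\succeq0$ and $B(\bar x)\succeq0$.
   Context: $\mathbb{S}^n$ is the set of real symmetric $n\times n$ matrices, with inner product $\langle X,Y\rangle=\mathrm{tr}(XY)$. $X\succeq0$ (resp. $X\succ0$) means that $X$ is symmetric positive semidefinite (resp. positive definite); $X\succeq Y$ means $X-Y\succeq0$, and $X\succ Y$ means $X-Y\succ0$. A pair $(x,y)$ is feasible for (P) if $A(x,y)\succeq0$ and $B(x)\succeq0$. A number $y\in\mathbb{R}$ is called feasible if $(x,y)$ is feasible for some $x\in\mathbb{R}^m$, and a vector $x\in\mathbb{R}^m$ is called feasible if $(x,y)$ is feasible for some $y\in\mathbb{R}$. Matrix convexity and concavity: $F:\mathbb{R}^m\to\mathbb{S}^n$ is convex if $\lambda F(x)+(1-\lambda)F(x')\succeq F(\lambda x+(1-\lambda)x')$ for all $x,x'\in\mathbb{R}^m$ and $\lambda\in[0,1]$; $F$ is concave if $-F$ is convex. *)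

theory Defs
  imports "HOL-Analysis.Analysis"
begin

definition sym_mat :: "real^'n^'n \<Rightarrow> bool" where
  "sym_mat X \<longleftrightarrow> transpose X = X"

definition psd :: "real^'n^'n \<Rightarrow> bool" where
  "psd X \<longleftrightarrow> sym_mat X \<and> (\<forall>v. 0 \<le> v \<bullet> (X *v v))"

definition pd :: "real^'n^'n \<Rightarrow> bool" where
  "pd X \<longleftrightarrow> sym_mat X \<and> (\<forall>v. v \<noteq> 0 \<longrightarrow> 0 < v \<bullet> (X *v v))"

definition loewner_ge :: "real^'n^'n \<Rightarrow> real^'n^'n \<Rightarrow> bool"  (infix "\<succeq>" 50) where
  "X \<succeq> Y \<longleftrightarrow> psd (X - Y)"

definition loewner_gt :: "real^'n^'n \<Rightarrow> real^'n^'n \<Rightarrow> bool"  (infix "\<succ>" 50) where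
  "X \<succ> Y \<longleftrightarrow> pd (X - Y)"

definition tr_inner :: "real^'n^'n \<Rightarrow> real^'n^'n \<Rightarrow> real" where
  "tr_inner X Y = trace (X ** Y)"

definition matrix_convex :: "(real^'m \<Rightarrow> real^'n^'n) \<Rightarrow> bool" where
  "matrix_convex F \<longleftrightarrow> (\<forall>x x'. \<forall>l\<in>{0..1}.
     l *\<^sub>R F x + (1 - l) *\<^sub>R F x' \<succeq> F (l *\<^sub>R x + (1 - l) *\<^sub>R x'))"

definition matrix_concave :: "(real^'m \<Rightarrow> real^'n^'n) \<Rightarrow> bool" where
  "matrix_concave F \<longleftrightarrow> matrix_convex (\<lambda>x. - F x)"

text \<open>The partial derivative of \<open>F\<close> in the \<open>i\<close>-th coordinate at \<open>x\<close>. As with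
  \<^const>\<open>vector_derivative\<close> itself, the value is meaningful only where this derivative exists.\<close>

definition partial_deriv :: "'m \<Rightarrow> (real^'m \<Rightarrow> real^'n^'n) \<Rightarrow> real^'m \<Rightarrow> real^'n^'n" where
  "partial_deriv i F x = vector_derivative (\<lambda>t. F (x + t *\<^sub>R axis i 1)) (at 0)"

definition feasible ::
  "(real^'m \<Rightarrow> real \<Rightarrow> real^'n^'n) \<Rightarrow> (real^'m \<Rightarrow> real^'n^'n) \<Rightarrow> real^'m \<Rightarrow> real \<Rightarrow> bool" where
  "feasible A B x y \<longleftrightarrow> A x y \<succeq> 0 \<and> B x \<succeq> 0"

definition feasible_y ::
  "(real^'m \<Rightarrow> real \<Rightarrow> real^'n^'n) \<Rightarrow> (real^'m \<Rightarrow> real^'n^'n) \<Rightarrow> real \<Rightarrow> bool" where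
  "feasible_y A B y \<longleftrightarrow> (\<exists>x. feasible A B x y)"

definition feasible_x ::
  "(real^'m \<Rightarrow> real \<Rightarrow> real^'n^'n) \<Rightarrow> (real^'m \<Rightarrow> real^'n^'n) \<Rightarrow> real^'m \<Rightarrow> bool" where
  "feasible_x A B x \<longleftrightarrow> (\<exists>y. feasible A B x y)"

end

theory Submission
  imports Defs
begin

text \<open>If some feasible \<open>(xbar, ybar)\<close> had \<open>ybar < ys\<close>, monotonicity in \<open>y\<close> would make \<open>A xbar ys\<close>
  positive definite. Pairing the gradient inequalities of the concave maps \<open>A(\<cdot>, ys)\<close> and \<open>B\<close> at
  \<open>xs\<close> with the multipliers and summing, stationarity and complementarity give
  \<open>\<langle>A xbar ys, Zs\<rangle> + \<langle>B xbar, Ws\<rangle> \<le> 0\<close>. Both terms are nonnegative, so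
  \<open>\<langle>A xbar ys, Zs\<rangle> = 0\<close>; as \<open>A xbar ys\<close> is positive definite this forces \<open>Zs = 0\<close>, which contradicts
  the KKT condition in \<open>y\<close>. The sign of the trace pairing comes from writing a positive semidefinite
  matrix as a sum of matrices \<open>v v\<^sup>T\<close>, by Cholesky elimination.\<close>

section \<open>Positive semidefinite matrices as sums of rank-one matrices\<close>

lemma quadratic_form_eq_sum:
  fixes X :: "real^'n^'n"
  shows "v \<bullet> (X *v v) = (\<Sum>i\<in>UNIV. \<Sum>j\<in>UNIV. X $ i $ j * v $ i * v $ j)"
  by (simp add: inner_vec_def matrix_vector_mult_def sum_distrib_left mult_ac)

lemma sym_mat_nth: "sym_mat X \<Longrightarrow> X $ i $ j = X $ j $ i"
  unfolding sym_mat_def transpose_def by (subst (asm) vec_eq_iff) (simp add: vec_eq_iff)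

text \<open>A quadratic polynomial in \<open>t\<close> bounding the form at
  \<open>v + t *\<^sub>R axis k 1\<close>; different choices of \<open>t\<close> drive the
  elimination below.\<close>

lemma psd_two_point:
  fixes X :: "real^'n^'n"
  assumes "psd X"
  shows "0 \<le> v \<bullet> (X *v v) + 2 * t * (X *v v) $ k + t\<^sup>2 * X $ k $ k"
proof -
  have s: "axis k 1 \<bullet> (X *v v) = (X *v v) $ k"
    by (simp add: inner_axis')
  have s': "v \<bullet> (X *v axis k 1) = (X *v v) $ k"
    using assms unfolding psd_def sym_mat_def
    by (metis dot_lmul_matrix inner_commute s transpose_matrix_vector)
  have d: "axis k 1 \<bullet> (X *v axis k 1) = X $ k $ k"
    by (simp add: inner_axis' matrix_vector_mult_basis column_def)
  have "0 \<le> (v + t *\<^sub>R axis k 1) \<bullet> (X *v (v + t *\<^sub>R axis k 1))"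
    using assms by (simp add: psd_def)
  also have "\<dots> = v \<bullet> (X *v v) + 2 * t * (X *v v) $ k + t\<^sup>2 * X $ k $ k"
    unfolding matrix_vector_right_distrib matrix_vector_mult_scaleR inner_add_left inner_add_right
      inner_scaleR_left inner_scaleR_right s s' d power2_eq_square
    by (simp add: algebra_simps)
  finally show ?thesis .
qed

text \<open>With a zero diagonal entry the polynomial of \<open>psd_two_point\<close> is affine in
  \<open>t\<close>, and a nonnegative affine function has slope 0.\<close>

lemma psd_zero_diag_imp_zero_row:
  fixes X :: "real^'n^'n"
  assumes "psd X" "X $ k $ k = 0"
  shows "X $ k $ j = 0"
proof (rule ccontr)
  assume nz: "X $ k $ j \<noteq> 0"
  define v where "v = (axis j 1 :: real^'n)"
  define q where "q = v \<bullet> (X *v v)"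
  have e: "(X *v v) $ k = X $ k $ j"
    by (simp add: v_def matrix_vector_mult_basis column_def)
  \<comment> \<open>This \<open>t\<close> is chosen to make the right-hand side equal to -1.\<close>
  have "0 \<le> q + 2 * (- (q + 1) / (2 * X $ k $ j)) * X $ k $ j"
    using psd_two_point[OF assms(1), of v "- (q + 1) / (2 * X $ k $ j)" k] assms(2)
    by (simp add: e q_def)
  then show False using nz by (simp add: field_simps)
qed

text \<open>The set \<open>S\<close> of rows not yet eliminated is what the induction runs over;
  each step subtracts one rank-one matrix and clears row \<open>k\<close>.\<close>

lemma psd_outer_decomposition_on:
  fixes Z :: "real^'n^'n"
  assumes "finite S" "psd Z" "\<And>i j. i \<notin> S \<Longrightarrow> Z $ i $ j = 0"
  shows "\<exists>f :: 'n \<Rightarrow> real^'n. \<forall>i j. Z $ i $ j = (\<Sum>k\<in>S. f k $ i * f k $ j)"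
  using assms
proof (induction S arbitrary: Z rule: finite_induct)
  case empty
  then show ?case by simp
next
  case (insert k S)
  have sym: "Z $ i $ j = Z $ j $ i" for i j
    using insert.prems(1) by (auto simp: psd_def intro: sym_mat_nth)
  have nonneg: "0 \<le> Z $ k $ k"
    using psd_two_point[OF insert.prems(1), of 0 1 k] by simp
  \<comment> \<open>If \<open>Z $ k $ k = 0\<close> then row \<open>k\<close> vanishes, and \<open>c = 0\<close> by \<open>x / 0 = 0\<close>, so that no case distinction
    is needed in the construction.\<close>
  define c where "c = Z $ k /\<^sub>R sqrt (Z $ k $ k)"
  have cc: "c $ i * c $ j = Z $ k $ i * Z $ k $ j / Z $ k $ k" for i j
    using nonneg by (simp add: c_def divide_simps)
  define Z' where "Z' = (\<chi> i j. Z $ i $ j - c $ i * c $ j)"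
  have form: "v \<bullet> (Z' *v v) = v \<bullet> (Z *v v) - ((Z *v v) $ k)\<^sup>2 / Z $ k $ k" for v
  proof -
    have cv: "(\<Sum>i\<in>UNIV. c $ i * v $ i) = (Z *v v) $ k / sqrt (Z $ k $ k)"
      by (simp add: c_def matrix_vector_mult_def sum_divide_distrib divide_inverse sum_distrib_left mult_ac)
    have "v \<bullet> (Z' *v v) = v \<bullet> (Z *v v) - (\<Sum>i\<in>UNIV. c $ i * v $ i)\<^sup>2"
      by (simp add: quadratic_form_eq_sum Z'_def left_diff_distrib right_diff_distrib
          sum_subtractf power2_eq_square sum_product mult_ac)
    then show ?thesis using nonneg by (simp add: cv power_divide)
  qed
  have "psd Z'"
  proof -
    \<comment> \<open>For a nonzero pivot this \<open>t\<close> minimises the polynomial of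
      \<open>psd_two_point\<close>, and the minimum is the form of \<open>Z'\<close>. For a zero
      pivot \<open>t\<close> is 0 and the forms of \<open>Z'\<close> and \<open>Z\<close>
      agree.\<close>
    have "0 \<le> v \<bullet> (Z' *v v)" for v
      using psd_two_point[OF insert.prems(1), of v "- (Z *v v) $ k / Z $ k $ k" k]
      unfolding form by (cases "Z $ k $ k = 0") (simp_all add: power2_eq_square field_simps)
    moreover have "sym_mat Z'"
      by (simp add: sym_mat_def transpose_def vec_eq_iff Z'_def sym mult.commute)
    ultimately show ?thesis by (simp add: psd_def)
  qed
  moreover have "Z' $ i $ j = 0" if "i \<notin> S" for i j
  proof (cases "i = k")
    case True
    then show ?thesis
      using psd_zero_diag_imp_zero_row[OF insert.prems(1), of k j]
      by (cases "Z $ k $ k = 0") (simp_all add: Z'_def cc)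
  next
    case False
    then show ?thesis
      \<comment> \<open>Row \<open>i\<close> of \<open>Z\<close> vanishes, hence by symmetry so does
        \<open>Z $ k $ i\<close>, and nothing is subtracted in that row.\<close>
      using insert.prems(2)[of i] that sym[of k i] by (simp add: Z'_def cc)
  qed
  ultimately obtain f :: "'n \<Rightarrow> real^'n"
    where f: "\<And>i j. Z' $ i $ j = (\<Sum>k\<in>S. f k $ i * f k $ j)"
    using insert.IH by blast
  have "Z $ i $ j = (\<Sum>l\<in>insert k S. (f(k := c)) l $ i * (f(k := c)) l $ j)" for i j
  proof -
    have "(\<Sum>l\<in>S. (f(k := c)) l $ i * (f(k := c)) l $ j) = Z' $ i $ j"
      unfolding f using insert.hyps by (intro sum.cong) auto
    then show ?thesis using insert.hyps by (simp add: Z'_def)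
  qed
  then show ?case by blast
qed

text \<open>Pairing with a rank-one matrix built from \<open>v\<close> evaluates the quadratic form
  at \<open>v\<close>, so the trace pairing becomes a sum of such values.\<close>

lemma psd_outer_decomposition:
  fixes Z :: "real^'n^'n"
  assumes "psd Z"
  shows "\<exists>f :: 'n \<Rightarrow> real^'n. (\<forall>i j. Z $ i $ j = (\<Sum>k\<in>UNIV. f k $ i * f k $ j)) \<and>
    (\<forall>X. tr_inner X Z = (\<Sum>k\<in>UNIV. f k \<bullet> (X *v f k)))"
proof -
  obtain f :: "'n \<Rightarrow> real^'n" where f: "\<And>i j. Z $ i $ j = (\<Sum>k\<in>UNIV. f k $ i * f k $ j)"
    using psd_outer_decomposition_on[of UNIV Z] assms by auto
  have "tr_inner X Z = (\<Sum>k\<in>UNIV. f k \<bullet> (X *v f k))" for X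
  proof -
    have "tr_inner X Z = (\<Sum>i\<in>UNIV. \<Sum>j\<in>UNIV. \<Sum>k\<in>UNIV. X $ i $ j * f k $ i * f k $ j)"
      by (simp add: tr_inner_def trace_def matrix_matrix_mult_def f sum_distrib_left mult_ac)
    also have "\<dots> = (\<Sum>i\<in>UNIV. \<Sum>k\<in>UNIV. \<Sum>j\<in>UNIV. X $ i $ j * f k $ i * f k $ j)"
      by (intro sum.cong refl sum.swap)
    also have "\<dots> = (\<Sum>k\<in>UNIV. f k \<bullet> (X *v f k))"
      unfolding quadratic_form_eq_sum by (rule sum.swap)
    finally show ?thesis .
  qed
  with f show ?thesis by blast
qed

section \<open>Sign and definiteness of the trace pairing\<close>

lemma tr_inner_psd_nonneg:
  fixes X Z :: "real^'n^'n"
  assumes "psd X" "psd Z"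
  shows "0 \<le> tr_inner X Z"
proof -
  obtain f :: "'n \<Rightarrow> real^'n" where "\<And>X. tr_inner X Z = (\<Sum>k\<in>UNIV. f k \<bullet> (X *v f k))"
    using psd_outer_decomposition[OF assms(2)] by metis
  then show ?thesis using assms(1) by (simp add: psd_def sum_nonneg)
qed

text \<open>The pairing is a sum of nonnegative values of the form of \<open>X\<close>; each must
  vanish, so definiteness kills every \<open>f k\<close>.\<close>

lemma tr_inner_pd_eq_0_imp:
  fixes X Z :: "real^'n^'n"
  assumes "pd X" "psd Z" "tr_inner X Z = 0"
  shows "Z = 0"
proof -
  obtain f :: "'n \<Rightarrow> real^'n" where f: "\<forall>i j. Z $ i $ j = (\<Sum>k\<in>UNIV. f k $ i * f k $ j)"
    and tr: "\<forall>X. tr_inner X Z = (\<Sum>k\<in>UNIV. f k \<bullet> (X *v f k))"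
    using psd_outer_decomposition[OF assms(2)] by blast
  have pos: "v \<noteq> 0 \<Longrightarrow> 0 < v \<bullet> (X *v v)" for v
    using assms(1) by (simp add: pd_def)
  then have nonneg: "0 \<le> v \<bullet> (X *v v)" for v
    by (cases "v = 0") (auto intro: less_imp_le)
  have "f k \<bullet> (X *v f k) = 0" for k
    using assms(3) nonneg unfolding tr[rule_format] by (subst (asm) sum_nonneg_eq_0_iff) auto
  then have "f k = 0" for k
    using pos by force
  then show ?thesis by (simp add: vec_eq_iff f)
qed

section \<open>Derivatives and the gradient inequality for matrix-concave maps\<close>

lemma bounded_linear_tr_inner_left: "bounded_linear (\<lambda>X :: real^'n^'n. tr_inner X Z)"
proof -
  have "linear (\<lambda>X :: real^'n^'n. tr_inner X Z)"
    by (rule linearI)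
       (simp_all add: tr_inner_def trace_def matrix_matrix_mult_def sum_distrib_left sum.distrib
         distrib_right mult.assoc)
  then show ?thesis by (rule linear_conv_bounded_linear[THEN iffD1])
qed

lemma partial_deriv_eq:
  assumes "(F has_derivative D) (at x)"
  shows "partial_deriv i F x = D (axis i 1)"
proof -
  interpret D: bounded_linear D using assms by (rule has_derivative_bounded_linear)
  have "((\<lambda>t. x + t *\<^sub>R axis i 1) has_derivative (\<lambda>t. t *\<^sub>R axis i 1)) (at (0::real))"
    by (auto intro!: derivative_eq_intros)
  from has_derivative_compose[OF this, of F D] assms
  have "((\<lambda>t. F (x + t *\<^sub>R axis i 1)) has_vector_derivative D (axis i 1)) (at 0)"
    by (simp add: has_vector_derivative_def D.scaleR)
  then show ?thesis unfolding partial_deriv_def by (rule vector_derivative_at)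
qed

text \<open>Pairing with \<open>Z\<close> and restricting to the line from \<open>x\<close> to
  \<open>x'\<close> reduces this to a convex real function lying above its tangent at 0.\<close>

lemma matrix_concave_gradient_ineq:
  fixes F :: "real^'m \<Rightarrow> real^'n^'n"
  assumes "matrix_concave F" "F differentiable (at x)" "psd Z"
  shows "tr_inner (F x') Z
    \<le> tr_inner (F x) Z + (\<Sum>i\<in>UNIV. (x' - x) $ i * tr_inner (partial_deriv i F x) Z)"
proof -
  obtain D where D: "(F has_derivative D) (at x)"
    using assms(2) by (auto simp: differentiable_def)
  interpret D: bounded_linear D using D by (rule has_derivative_bounded_linear)
  interpret L: bounded_linear "\<lambda>X :: real^'n^'n. tr_inner X Z"
    by (rule bounded_linear_tr_inner_left)
  define h where "h = x' - x"
  define g where "g t = - tr_inner (F (x + t *\<^sub>R h)) Z" for t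
  have "convex_on UNIV g"
  proof (rule convex_onI)
    fix t s u :: real
    assume t: "0 < t" "t < 1"
    \<comment> \<open>\<open>convex_onI\<close> gives the first point weight \<open>1 - t\<close>,
      so \<open>l\<close> is instantiated with \<open>1 - t\<close> and the second weight appears as
      \<open>1 - (1 - t)\<close>.\<close>
    have "psd ((1 - t) *\<^sub>R - F (x + s *\<^sub>R h) + (1 - (1 - t)) *\<^sub>R - F (x + u *\<^sub>R h)
      - - F ((1 - t) *\<^sub>R (x + s *\<^sub>R h) + (1 - (1 - t)) *\<^sub>R (x + u *\<^sub>R h)))"
      using assms(1)[unfolded matrix_concave_def matrix_convex_def loewner_ge_def, rule_format, of "1 - t"] t
      by simp
    moreover have "(1 - t) *\<^sub>R (x + s *\<^sub>R h) + (1 - (1 - t)) *\<^sub>R (x + u *\<^sub>R h)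
        = x + ((1 - t) *\<^sub>R s + t *\<^sub>R u) *\<^sub>R h"
      by (simp add: algebra_simps)
    ultimately have "0 \<le> tr_inner ((1 - t) *\<^sub>R - F (x + s *\<^sub>R h) + t *\<^sub>R - F (x + u *\<^sub>R h)
      - - F (x + ((1 - t) *\<^sub>R s + t *\<^sub>R u) *\<^sub>R h)) Z"
      using assms(3) by (simp add: tr_inner_psd_nonneg)
    then show "g ((1 - t) *\<^sub>R s + t *\<^sub>R u) \<le> (1 - t) * g s + t * g u"
      by (simp add: g_def L.add L.diff L.neg L.scaleR)
  qed simp
  moreover have "(g has_field_derivative - tr_inner (D h) Z) (at 0)"
  proof -
    have "((\<lambda>t. x + t *\<^sub>R h) has_derivative (\<lambda>t. t *\<^sub>R h)) (at (0::real))"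
      by (auto intro!: derivative_eq_intros)
    from has_derivative_compose[OF this, of F D] D
    have "((\<lambda>t. F (x + t *\<^sub>R h)) has_derivative (\<lambda>t. t *\<^sub>R D h)) (at 0)"
      by (simp add: D.scaleR)
    from has_derivative_minus[OF L.has_derivative[OF this]] show ?thesis
      unfolding has_field_derivative_def g_def[abs_def]
      by (rule has_derivative_eq_rhs) (simp add: fun_eq_iff L.scaleR)
  qed
  ultimately have "g 1 - g 0 \<ge> - tr_inner (D h) Z * (1 - 0)"
    by (intro convex_on_imp_above_tangent[of UNIV]) auto
  then have "tr_inner (F x') Z \<le> tr_inner (F x) Z + tr_inner (D h) Z"
    by (simp add: g_def h_def)
  \<comment> \<open>Expanding \<open>h\<close> in the standard basis brings in the partial
    derivatives of the stationarity condition.\<close>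
  also have "D h = (\<Sum>i\<in>UNIV. h $ i *\<^sub>R D (axis i 1))"
    using arg_cong[OF basis_expansion[of h], of D]
    by (simp add: D.sum D.scaleR scalar_mult_eq_scaleR del: basis_expansion)
  also have "tr_inner \<dots> Z = (\<Sum>i\<in>UNIV. h $ i * tr_inner (partial_deriv i F x) Z)"
    by (simp add: L.sum L.scaleR partial_deriv_eq[OF D])
  finally show ?thesis by (simp add: h_def)
qed

theorem theorem4p1:
  fixes A :: "real^'m \<Rightarrow> real \<Rightarrow> real^'n^'n"
    and B :: "real^'m \<Rightarrow> real^'n^'n"
    and xs :: "real^'m" and ys :: real
    and Zs Ws :: "real^'n^'n"
  assumes A_sym: "\<And>x y. sym_mat (A x y)"
    and B_sym: "\<And>x. sym_mat (B x)"
    and A_diff_x: "\<And>y. feasible_y A B y \<Longrightarrow> (\<lambda>x. A x y) differentiable_on UNIV"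
    and A_concave: "\<And>y. feasible_y A B y \<Longrightarrow> matrix_concave (\<lambda>x. A x y)"
    and B_diff: "B differentiable_on UNIV"
    and B_concave: "matrix_concave B"
    and A_diff_y: "\<And>x. feasible_x A B x \<Longrightarrow> (\<lambda>y. A x y) differentiable_on UNIV"
    and A_incr: "\<And>x y y'. feasible_x A B x \<Longrightarrow> y > y' \<Longrightarrow> A x y \<succ> A x y'"
    and Zs_sym: "sym_mat Zs" and Ws_sym: "sym_mat Ws"
    and KKT_x: "\<And>i. tr_inner (partial_deriv i (\<lambda>x. A x ys) xs) Zs
                    + tr_inner (partial_deriv i B xs) Ws = 0"
    and KKT_y: "1 - tr_inner (vector_derivative (\<lambda>y. A xs y) (at ys)) Zs = 0"
    and compl_A: "tr_inner (A xs ys) Zs = 0"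
    and compl_B: "tr_inner (B xs) Ws = 0"
    and A_psd: "A xs ys \<succeq> 0"
    and B_psd: "B xs \<succeq> 0"
    and Z_psd: "Zs \<succeq> 0"
    and W_psd: "Ws \<succeq> 0"
  shows "feasible A B xs ys \<and>
    (\<forall>xbar ybar. A xbar ybar \<succeq> 0 \<and> B xbar \<succeq> 0 \<longrightarrow> ys \<le> ybar)"
proof (intro conjI allI impI)
  show feas: "feasible A B xs ys"
    using A_psd B_psd by (simp add: feasible_def)
  fix xbar ybar
  assume bar: "A xbar ybar \<succeq> 0 \<and> B xbar \<succeq> 0"
  show "ys \<le> ybar"
  proof (rule ccontr)
    assume "\<not> ys \<le> ybar"
    moreover have "feasible_x A B xbar"
      using bar by (auto simp: feasible_x_def feasible_def)
    ultimately have gt: "A xbar ys \<succ> A xbar ybar"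
      by (simp add: A_incr)
    have pdA: "pd (A xbar ys)"
    proof -
      have "0 < v \<bullet> (A xbar ys *v v)" if "v \<noteq> 0" for v
      proof -
        have "0 < v \<bullet> ((A xbar ys - A xbar ybar) *v v)"
          using gt that by (simp add: loewner_gt_def pd_def)
        moreover have "0 \<le> v \<bullet> (A xbar ybar *v v)"
          using bar by (simp add: loewner_ge_def psd_def)
        ultimately show ?thesis
          by (simp add: matrix_vector_mult_diff_rdistrib inner_diff_right)
      qed
      then show ?thesis using A_sym by (simp add: pd_def)
    qed
    then have psdA: "psd (A xbar ys)"
      unfolding pd_def psd_def by (metis inner_zero_left less_imp_le order_refl)
    have Z: "psd Zs" and W: "psd Ws" and psdB: "psd (B xbar)"
      using Z_psd W_psd bar by (simp_all add: loewner_ge_def)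
    \<comment> \<open>The point \<open>xs\<close> witnesses feasibility of \<open>ys\<close>, which
      makes concavity and differentiability of \<open>A\<close> in \<open>x\<close> available at
      this level.\<close>
    have ys: "feasible_y A B ys"
      using feas by (auto simp: feasible_y_def)
    let ?h = "xbar - xs"
    let ?dA = "\<lambda>i. tr_inner (partial_deriv i (\<lambda>x. A x ys) xs) Zs"
    let ?dB = "\<lambda>i. tr_inner (partial_deriv i B xs) Ws"
    have "tr_inner (A xbar ys) Zs \<le> (\<Sum>i\<in>UNIV. ?h $ i * ?dA i)"
      using matrix_concave_gradient_ineq[OF A_concave[OF ys] _ Z, of xs xbar] A_diff_x[OF ys]
      by (simp add: compl_A differentiable_on_def)
    moreover have "tr_inner (B xbar) Ws \<le> (\<Sum>i\<in>UNIV. ?h $ i * ?dB i)"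
      using matrix_concave_gradient_ineq[OF B_concave _ W, of xs xbar] B_diff
      by (simp add: compl_B differentiable_on_def)
    moreover have "(\<Sum>i\<in>UNIV. ?h $ i * ?dA i) + (\<Sum>i\<in>UNIV. ?h $ i * ?dB i) = 0"
      by (simp only: sum.distrib[symmetric] distrib_left[symmetric] KKT_x mult_zero_right sum.neutral_const)
    ultimately have "tr_inner (A xbar ys) Zs = 0"
      using tr_inner_psd_nonneg[OF psdA Z] tr_inner_psd_nonneg[OF psdB W] by linarith
    then have "Zs = 0"
      by (rule tr_inner_pd_eq_0_imp[OF pdA Z])
    then show False
      using KKT_y by (simp add: tr_inner_def trace_def matrix_matrix_mult_def)
  qed
qed

end
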